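(* Let $\mathbb{K}$ be a (Hausdorff, non-discrete) topological field and let $A$ be a continuous inverse algebra over $\mathbb{K}$. Then the inversion map $\iota\colon A^\times\to A$, $a\mapsto a^{-1}$, is of class $C^\infty_{\mathbb{K}}$, and thus the group of units $A^\times$ is a $\mathbb{K}$-Lie group when considered as an open submanifold of $A$.
   Context: All topological spaces, topological fields and topological vector spaces are Hausdorff; topological fields are non-discrete. Continuous inverse algebra over $\mathbb{K}$: a unital associative topological $\mathbb{K}$-algebra $A$ whose group of units $A^\times$ is open in $A$ and whose inversion map $A^\times\to A$ is continuous. Differential calculus over $\mathbb{K}$: For a topological $\mathbb{K}$-vector space $E$ and $U\subseteq E$ open, put $U^{[0]}:=U$, $U^{[1]}:=\{(x,y,t)\in U\times E\times\mathbb{K}: x+ty\in U\}$ and $U^{[j+1]}:=(U^{[j]})^{[1]}$. A map $f\colon U\to F$ into a topological $\mathbb{K}$-vector space is $C^0_{\mathbb{K}}$ if it is continuous ($f^{[0]}:=f$); it is $C^1_{\mathbb{K}}$ if it is continuous and there is a (necessarily unique) continuous map $f^{[1]}\colon U^{[1]}\to F$ with $f^{[1]}(x,y,t)=\frac1t(f(x+ty)-f(x))$ for all $(x,y,t)\in U^{[1]}$ with $t\neq0$; for $k\ge2$ it is $C^k_{\mathbb{K}}$ if it is $C^{k-1}_{\mathbb{K}}$ and $f^{[k-1]}$ is $C^1_{\mathbb{K}}$, and then $f^{[k]}:=(f^{[k-1]})^{[1]}$; it is $C^\infty_{\mathbb{K}}$ (smooth) if it is $C^k_{\mathbb{K}}$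 for all $k\in\mathbb{N}_0$. Compositions of composable $C^k$-maps are $C^k$, so $C^k$-manifolds modeled on topological $\mathbb{K}$-vector spaces are defined as usual by atlases. A $\mathbb{K}$-Lie group is a group with a $C^\infty_{\mathbb{K}}$-manifold structure modeled on a topological $\mathbb{K}$-vector space such that multiplication and inversion are $C^\infty_{\mathbb{K}}$. *)

theory Defs
  imports "HOL-Analysis.Analysis" "HOL-Algebra.Group"
begin

section \<open>Topological fields, vector spaces and continuous inverse algebras\<close>

class topological_field =
  field + topological_ab_group_add + topological_semigroup_mult + t2_space +
  assumes tendsto_inverse_nhds: "a \<noteq> 0 \<Longrightarrow> (inverse \<longlongrightarrow> inverse a) (nhds a)"
    and not_discrete: "\<exists>S. \<not> open S"

locale topological_vector_space = vector_space smul
  for smul :: "'k::topological_field \<Rightarrow> 'e::{topological_ab_group_add, t2_space} \<Rightarrow> 'e" +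
  assumes continuous_scale: "continuous_on UNIV (\<lambda>(t, x). smul t x)"

definition mult_monoid :: "'a::monoid_mult monoid" where
  "mult_monoid = \<lparr>carrier = UNIV, monoid.mult = (*), one = 1\<rparr>"

text \<open>
  The algebra is neither assumed to be commutative nor to satisfy \<open>0 \<noteq> 1\<close>; this is why the sort
  combines \<^class>\<open>ring\<close> with \<^class>\<open>monoid_mult\<close> instead of using \<^class>\<open>ring_1\<close>.
\<close>

locale continuous_inverse_algebra = topological_vector_space smul
  for smul :: "'k::topological_field \<Rightarrow>
      'a::{ring, monoid_mult, topological_ab_group_add, topological_semigroup_mult, t2_space} \<Rightarrow> 'a" +
  assumes scale_mult_left: "smul t x * y = smul t (x * y)"
    and scale_mult_right: "x * smul t y = smul t (x * y)"
    and open_Units: "open (Units (mult_monoid :: 'a monoid))"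
    and continuous_on_m_inv: "continuous_on (Units (mult_monoid :: 'a monoid)) (m_inv mult_monoid)"

section \<open>Differential calculus over topological fields\<close>

text \<open>
  With \<open>E\<^sup>[\<^sup>0\<^sup>] = E\<close> and \<open>E\<^sup>[\<^sup>n\<^sup>+\<^sup>1\<^sup>] = E\<^sup>[\<^sup>n\<^sup>] \<times> E\<^sup>[\<^sup>n\<^sup>] \<times> K\<close>, the domain \<open>U\<^sup>[\<^sup>n\<^sup>]\<close> of an iterated
  difference quotient map is a subset of \<open>E\<^sup>[\<^sup>n\<^sup>]\<close>, whose HOL type would depend on \<open>n\<close>. The following
  datatype contains all the spaces \<open>E\<^sup>[\<^sup>n\<^sup>]\<close>; the elements of \<open>E\<^sup>[\<^sup>n\<^sup>]\<close> are the trees all of whose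
  branches have length \<open>n\<close>, i.e. \<open>ext_space n\<close>. The vector space operations on \<open>E\<^sup>[\<^sup>n\<^sup>]\<close> are
  componentwise (and only meaningful for two arguments from the same \<open>E\<^sup>[\<^sup>n\<^sup>]\<close>), its topology is
  the product topology.
\<close>

datatype ('e, 'k) ext_point =
    Base (base: 'e)
  | Ext (ext_pt: "('e, 'k) ext_point") (ext_dir: "('e, 'k) ext_point") (ext_par: 'k)

primrec ext_space :: "nat \<Rightarrow> ('e, 'k) ext_point set" where
  "ext_space 0 = range Base"
| "ext_space (Suc n) = {Ext x y t | x y t. x \<in> ext_space n \<and> y \<in> ext_space n}"

primrec ext_topology ::
    "nat \<Rightarrow> ('e::topological_space, 'k::topological_space) ext_point topology" where
  "ext_topology 0 = pullback_topology (ext_space 0) base euclidean"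
| "ext_topology (Suc n) = pullback_topology (ext_space (Suc n))
     (\<lambda>p. (ext_pt p, ext_dir p, ext_par p))
     (prod_topology (ext_topology n) (prod_topology (ext_topology n) euclidean))"

fun ext_add :: "('e::plus, 'k::plus) ext_point \<Rightarrow> ('e, 'k) ext_point \<Rightarrow> ('e, 'k) ext_point" where
  "ext_add (Base x) (Base x') = Base (x + x')"
| "ext_add (Ext x y t) (Ext x' y' t') = Ext (ext_add x x') (ext_add y y') (t + t')"

primrec ext_scale ::
    "('k::times \<Rightarrow> 'e \<Rightarrow> 'e) \<Rightarrow> 'k \<Rightarrow> ('e, 'k) ext_point \<Rightarrow> ('e, 'k) ext_point" where
  "ext_scale smul s (Base x) = Base (smul s x)"
| "ext_scale smul s (Ext x y t) = Ext (ext_scale smul s x) (ext_scale smul s y) (s * t)"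

text \<open>\<open>ext_dom1 smul n V\<close> is \<open>V\<^sup>[\<^sup>1\<^sup>]\<close> for a subset \<open>V\<close> of the vector space \<open>E\<^sup>[\<^sup>n\<^sup>]\<close>.\<close>

definition ext_dom1 ::
    "('k::field \<Rightarrow> 'e::ab_group_add \<Rightarrow> 'e) \<Rightarrow> nat \<Rightarrow> ('e, 'k) ext_point set \<Rightarrow> ('e, 'k) ext_point set"
  where "ext_dom1 smul n V =
    {Ext x y t | x y t. x \<in> V \<and> y \<in> ext_space n \<and> ext_add x (ext_scale smul t y) \<in> V}"

primrec ext_dom ::
    "('k::field \<Rightarrow> 'e::ab_group_add \<Rightarrow> 'e) \<Rightarrow> 'e set \<Rightarrow> nat \<Rightarrow> ('e, 'k) ext_point set" where
  "ext_dom smul U 0 = Base ` U"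
| "ext_dom smul U (Suc n) = ext_dom1 smul n (ext_dom smul U n)"

text \<open>\<open>is_ext1 smul smul' n V f g\<close>: \<open>g\<close> qualifies as \<open>f\<^sup>[\<^sup>1\<^sup>]\<close>, where \<open>f\<close> is defined on \<open>V \<subseteq> E\<^sup>[\<^sup>n\<^sup>]\<close>.\<close>

definition is_ext1 ::
    "('k::topological_field \<Rightarrow> 'e::{ab_group_add, topological_space} \<Rightarrow> 'e) \<Rightarrow>
     ('k \<Rightarrow> 'f::{ab_group_add, topological_space} \<Rightarrow> 'f) \<Rightarrow>
     nat \<Rightarrow> ('e, 'k) ext_point set \<Rightarrow>
     (('e, 'k) ext_point \<Rightarrow> 'f) \<Rightarrow> (('e, 'k) ext_point \<Rightarrow> 'f) \<Rightarrow> bool"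
  where "is_ext1 smul smul' n V f g \<longleftrightarrow>
    continuous_map (subtopology (ext_topology (Suc n)) (ext_dom1 smul n V)) euclidean g \<and>
    (\<forall>x y t. Ext x y t \<in> ext_dom1 smul n V \<and> t \<noteq> 0 \<longrightarrow>
       g (Ext x y t) = smul' (1 / t) (f (ext_add x (ext_scale smul t y)) - f x))"

definition ext_C1 ::
    "('k::topological_field \<Rightarrow> 'e::{ab_group_add, topological_space} \<Rightarrow> 'e) \<Rightarrow>
     ('k \<Rightarrow> 'f::{ab_group_add, topological_space} \<Rightarrow> 'f) \<Rightarrow>
     nat \<Rightarrow> ('e, 'k) ext_point set \<Rightarrow> (('e, 'k) ext_point \<Rightarrow> 'f) \<Rightarrow> bool"
  where "ext_C1 smul smul' n V f \<longleftrightarrow>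
    continuous_map (subtopology (ext_topology n) V) euclidean f \<and>
    (\<exists>g. is_ext1 smul smul' n V f g)"

text \<open>
  \<open>ext_fun smul smul' U f n\<close> is \<open>f\<^sup>[\<^sup>n\<^sup>]\<close>. On its domain \<open>U\<^sup>[\<^sup>n\<^sup>]\<close> the choice is unique (the field is
  not discrete and the spaces are Hausdorff); values outside the domain are arbitrary and irrelevant.
\<close>

primrec ext_fun ::
    "('k::topological_field \<Rightarrow> 'e::{ab_group_add, topological_space} \<Rightarrow> 'e) \<Rightarrow>
     ('k \<Rightarrow> 'f::{ab_group_add, topological_space} \<Rightarrow> 'f) \<Rightarrow>
     'e set \<Rightarrow> ('e \<Rightarrow> 'f) \<Rightarrow> nat \<Rightarrow> ('e, 'k) ext_point \<Rightarrow> 'f" where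
  "ext_fun smul smul' U f 0 = f \<circ> base"
| "ext_fun smul smul' U f (Suc n) =
     (SOME g. is_ext1 smul smul' n (ext_dom smul U n) (ext_fun smul smul' U f n) g)"

primrec C_k_on ::
    "nat \<Rightarrow> ('k::topological_field \<Rightarrow> 'e::{ab_group_add, topological_space} \<Rightarrow> 'e) \<Rightarrow>
     ('k \<Rightarrow> 'f::{ab_group_add, topological_space} \<Rightarrow> 'f) \<Rightarrow> 'e set \<Rightarrow> ('e \<Rightarrow> 'f) \<Rightarrow> bool" where
  "C_k_on 0 smul smul' U f \<longleftrightarrow> open U \<and> continuous_on U f"
| "C_k_on (Suc k) smul smul' U f \<longleftrightarrow>
     C_k_on k smul smul' U f \<and>
     ext_C1 smul smul' k (ext_dom smul U k) (ext_fun smul smul' U f k)"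

definition C_infinity_on ::
    "('k::topological_field \<Rightarrow> 'e::{ab_group_add, topological_space} \<Rightarrow> 'e) \<Rightarrow>
     ('k \<Rightarrow> 'f::{ab_group_add, topological_space} \<Rightarrow> 'f) \<Rightarrow> 'e set \<Rightarrow> ('e \<Rightarrow> 'f) \<Rightarrow> bool"
  where "C_infinity_on smul smul' U f \<longleftrightarrow> (\<forall>k. C_k_on k smul smul' U f)"

section \<open>Smooth manifolds\<close>

text \<open>
  A chart of a manifold with underlying space \<open>X\<close> is a pair \<open>(U, \<phi>)\<close> of an open set \<open>U\<close> and a map
  whose restriction to \<open>U\<close> is a homeomorphism onto an open subset of the modelling space.
  An atlas need not be maximal.
\<close>

type_synonym ('m, 'e) chart = "'m set \<times> ('m \<Rightarrow> 'e)"

definition is_chart :: "'m topology \<Rightarrow> ('m, 'e::topological_space) chart \<Rightarrow> bool" where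
  "is_chart X = (\<lambda>(U, \<phi>). openin X U \<and> open (\<phi> ` U) \<and>
     homeomorphic_map (subtopology X U) (top_of_set (\<phi> ` U)) \<phi>)"

definition smooth_manifold ::
    "('k::topological_field \<Rightarrow> 'e::{ab_group_add, topological_space} \<Rightarrow> 'e) \<Rightarrow>
     'm topology \<Rightarrow> ('m, 'e) chart set \<Rightarrow> bool" where
  "smooth_manifold smul X \<A> \<longleftrightarrow>
     Hausdorff_space X \<and>
     (\<forall>c\<in>\<A>. is_chart X c) \<and>
     (\<Union>(U, \<phi>)\<in>\<A>. U) = topspace X \<and>
     (\<forall>(U, \<phi>)\<in>\<A>. \<forall>(V, \<psi>)\<in>\<A>.
        C_infinity_on smul smul (\<phi> ` (U \<inter> V)) (\<psi> \<circ> inv_into U \<phi>))"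

definition smooth_map ::
    "('k::topological_field \<Rightarrow> 'e::{ab_group_add, topological_space} \<Rightarrow> 'e) \<Rightarrow>
     'm topology \<Rightarrow> ('m, 'e) chart set \<Rightarrow>
     ('k \<Rightarrow> 'f::{ab_group_add, topological_space} \<Rightarrow> 'f) \<Rightarrow>
     'n topology \<Rightarrow> ('n, 'f) chart set \<Rightarrow> ('m \<Rightarrow> 'n) \<Rightarrow> bool" where
  "smooth_map smul X \<A> smul' Y \<B> f \<longleftrightarrow>
     continuous_map X Y f \<and>
     (\<forall>(U, \<phi>)\<in>\<A>. \<forall>(V, \<psi>)\<in>\<B>.
        C_infinity_on smul smul' (\<phi> ` {x \<in> U. f x \<in> V}) (\<psi> \<circ> f \<circ> inv_into U \<phi>))"

definition model_atlas :: "('e, 'e) chart set" where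
  "model_atlas = {(UNIV, \<lambda>x. x)}"

definition open_submanifold_atlas :: "'m set \<Rightarrow> ('m, 'e) chart set \<Rightarrow> ('m, 'e) chart set" where
  "open_submanifold_atlas W \<A> = {(U \<inter> W, \<phi>) | U \<phi>. (U, \<phi>) \<in> \<A>}"

definition prod_atlas ::
    "('m, 'e) chart set \<Rightarrow> ('n, 'f) chart set \<Rightarrow> ('m \<times> 'n, 'e \<times> 'f) chart set" where
  "prod_atlas \<A> \<B> = {(U \<times> V, map_prod \<phi> \<psi>) | U \<phi> V \<psi>. (U, \<phi>) \<in> \<A> \<and> (V, \<psi>) \<in> \<B>}"

definition prod_scale ::
    "('k \<Rightarrow> 'e \<Rightarrow> 'e) \<Rightarrow> ('k \<Rightarrow> 'f \<Rightarrow> 'f) \<Rightarrow> 'k \<Rightarrow> 'e \<times> 'f \<Rightarrow> 'e \<times> 'f" where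
  "prod_scale smul smul' t = map_prod (smul t) (smul' t)"

section \<open>Lie groups\<close>

definition lie_group ::
    "('k::topological_field \<Rightarrow> 'e::{topological_ab_group_add, t2_space} \<Rightarrow> 'e) \<Rightarrow>
     'g monoid \<Rightarrow> 'g topology \<Rightarrow> ('g, 'e) chart set \<Rightarrow> bool" where
  "lie_group smul G X \<A> \<longleftrightarrow>
     topological_vector_space smul \<and>
     group G \<and> topspace X = carrier G \<and>
     smooth_manifold smul X \<A> \<and>
     smooth_map (prod_scale smul smul) (prod_topology X X) (prod_atlas \<A> \<A>) smul X \<A>
       (\<lambda>(x, y). x \<otimes>\<^bsub>G\<^esub> y) \<and>
     smooth_map smul X \<A> smul X \<A> (m_inv G)"

end

theory Submission
  imports Defs
begin

text \<open>
  The difference quotient of inversion is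
  \<open>\<iota>\<^sup>[\<^sup>1\<^sup>](x, y, t) = - (x + t y)\<^sup>-\<^sup>1 y x\<^sup>-\<^sup>1\<close>, which is again built from continuous linear maps by
  multiplication and inversion. More generally, the maps on \<open>U\<^sup>[\<^sup>n\<^sup>]\<close> that are obtained from
  continuous linear maps by scalar multiplication with continuous linear functionals, sums,
  products and inversion are continuous, and each such \<open>f\<close> has an \<open>f\<^sup>[\<^sup>1\<^sup>]\<close> of the same kind on
  \<open>U\<^sup>[\<^sup>n\<^sup>+\<^sup>1\<^sup>]\<close>. As \<open>f\<^sup>[\<^sup>1\<^sup>]\<close> is unique, all these maps are smooth; this applies to inversion and to
  multiplication.
\<close>

section \<open>Continuity\<close>

lemma continuous_map_compose2:
  fixes h :: "'b::topological_space \<Rightarrow> 'c::topological_space \<Rightarrow> 'd::topological_space"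
  assumes "continuous_on UNIV (\<lambda>(a, b). h a b)"
    and "continuous_map X euclidean f" and "continuous_map X euclidean g"
  shows "continuous_map X euclidean (\<lambda>x. h (f x) (g x))"
proof -
  have "continuous_map X euclidean (\<lambda>x. (f x, g x))"
    using continuous_map_pairedI[OF assms(2,3)] by simp
  then have "continuous_map X euclidean ((\<lambda>(a, b). h a b) \<circ> (\<lambda>x. (f x, g x)))"
    using assms(1) by (meson continuous_map_compose continuous_map_iff_continuous2)
  then show ?thesis
    by (simp add: o_def)
qed

lemma continuous_on_plus_pair:
  "continuous_on UNIV (\<lambda>(a, b). a + b :: 'a::topological_monoid_add)"
  unfolding case_prod_beta by (intro continuous_intros)

lemma continuous_on_times_pair:
  "continuous_on UNIV (\<lambda>(a, b). a * b :: 'a::topological_semigroup_mult)"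
  unfolding case_prod_beta continuous_on_def
  by (intro ballI tendsto_mult tendsto_fst tendsto_snd tendsto_ident_at)

lemma continuous_map_uminus:
  fixes f :: "'a \<Rightarrow> 'b::topological_group_add"
  assumes "continuous_map X euclidean f"
  shows "continuous_map X euclidean (\<lambda>x. - f x)"
proof -
  have "continuous_on UNIV (uminus :: 'b \<Rightarrow> 'b)"
    by (intro continuous_intros)
  then have "continuous_map X euclidean (uminus \<circ> f)"
    using assms by (meson continuous_map_compose continuous_map_iff_continuous2)
  then show ?thesis
    by (simp add: o_def)
qed

text \<open>These product instances make \<open>'a \<times> 'a\<close> an admissible model space, so
  that multiplication can be treated by the same differential calculus as inversion.\<close>

instance prod :: (topological_monoid_add, topological_monoid_add) topological_monoid_add
proof
  fix a b :: "'a \<times> 'b"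
  have "((\<lambda>x. (fst (fst x) + fst (snd x), snd (fst x) + snd (snd x))) \<longlongrightarrow>
      (fst a + fst b, snd a + snd b)) (nhds (a, b))"
    by (auto intro!: tendsto_Pair tendsto_add tendsto_fst tendsto_snd tendsto_eq_intros filterlim_ident)
  then show "((\<lambda>x. fst x + snd x) \<longlongrightarrow> a + b) (nhds a \<times>\<^sub>F nhds b)"
    by (simp add: nhds_prod plus_prod_def)
qed

instance prod :: (topological_comm_monoid_add, topological_comm_monoid_add)
  topological_comm_monoid_add ..

instance prod :: (topological_group_add, topological_group_add) topological_group_add
proof
  fix a :: "'a \<times> 'b"
  have "((\<lambda>x. (- fst x, - snd x)) \<longlongrightarrow> (- fst a, - snd a)) (nhds a)"
    by (intro tendsto_intros filterlim_ident)
  then show "(uminus \<longlongrightarrow> - a) (nhds a)"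
    by (simp add: uminus_prod_def[abs_def])
qed

instance prod :: (topological_ab_group_add, topological_ab_group_add) topological_ab_group_add ..

text \<open>Translations are continuous, so one isolated point would make every point isolated and
  the field discrete. This is what makes limits for t tending to 0 unique.\<close>

lemma at_neq_bot_topological_field: "at (a :: 'k::topological_field) \<noteq> bot"
proof
  assume "at a = bot"
  then have a: "open {a}"
    by (simp add: at_eq_bot_iff)
  have "open {x}" for x :: 'k
  proof -
    have "continuous_on UNIV (\<lambda>y :: 'k. y + (a - x))"
      by (intro continuous_intros)
    then have "open ((\<lambda>y. y + (a - x)) -` {a})"
      using a by (simp add: continuous_on_open_vimage)
    moreover have "(\<lambda>y. y + (a - x)) -` {a} = {x}"
      by (auto simp: algebra_simps)
    ultimately show ?thesis
      by simp
  qed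
  then have "open S" for S :: "'k set"
    by (metis UN_singleton open_UN)
  then show False
    using not_discrete by blast
qed

section \<open>The extended spaces\<close>

text \<open>The endpoint x + t y of the increment, written with selectors so that it is a map on the
  whole extended space whose continuity can be stated and which can be composed with other
  maps.\<close>

definition ext_shift ::
    "('k::field \<Rightarrow> 'e::ab_group_add \<Rightarrow> 'e) \<Rightarrow> ('e, 'k) ext_point \<Rightarrow> ('e, 'k) ext_point" where
  "ext_shift smul p = ext_add (ext_pt p) (ext_scale smul (ext_par p) (ext_dir p))"

lemma ext_shift_Ext [simp]: "ext_shift smul (Ext x y t) = ext_add x (ext_scale smul t y)"
  by (simp add: ext_shift_def)

lemma ext_add_space:
  "x \<in> ext_space n \<Longrightarrow> y \<in> ext_space n \<Longrightarrow> ext_add x y \<in> ext_space n"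
  by (induction n arbitrary: x y) auto

lemma ext_scale_space: "x \<in> ext_space n \<Longrightarrow> ext_scale smul t x \<in> ext_space n"
  by (induction n arbitrary: x) auto

lemma ext_pt_space: "p \<in> ext_space (Suc n) \<Longrightarrow> ext_pt p \<in> ext_space n"
  and ext_dir_space: "p \<in> ext_space (Suc n) \<Longrightarrow> ext_dir p \<in> ext_space n"
  by auto

text \<open>This form exhibits the extended domain as an intersection of preimages of V under base
  point and endpoint; openness of the domain is read off from it.\<close>

lemma ext_dom1_iff:
  assumes "V \<subseteq> ext_space n"
  shows "p \<in> ext_dom1 smul n V \<longleftrightarrow>
    p \<in> ext_space (Suc n) \<and> ext_pt p \<in> V \<and> ext_shift smul p \<in> V"
  using assms by (cases p) (auto simp: ext_dom1_def)

lemma ext_dom1_subset: "V \<subseteq> ext_space n \<Longrightarrow> ext_dom1 smul n V \<subseteq> ext_space (Suc n)"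
  by (auto simp: ext_dom1_def)

lemma ext_dom_subset: "ext_dom smul U n \<subseteq> ext_space n"
proof (induction n)
  case (Suc n)
  then show ?case
    using ext_dom1_subset by simp
qed auto

section \<open>Topology and vector space operations of the spaces \<open>E^[n]\<close>\<close>

lemma topspace_ext_topology: "topspace (ext_topology n) = ext_space n"
  by (induction n) (auto simp: topspace_pullback_topology)

text \<open>The universal property of the initial topology. The two rules derived from it reduce
  continuity into \<open>E^[n]\<close> to continuity of the components.\<close>

lemma continuous_map_pullback_iff:
  "continuous_map X (pullback_topology A f T) g \<longleftrightarrow>
    g \<in> topspace X \<rightarrow> A \<and> continuous_map X T (f \<circ> g)"
proof
  assume L: "continuous_map X (pullback_topology A f T) g"
  have "continuous_map (pullback_topology A f T) T (id \<circ> f)"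
    by (intro continuous_map_pullback continuous_map_id)
  with L have "continuous_map X T (f \<circ> g)"
    using continuous_map_compose by fastforce
  then show "g \<in> topspace X \<rightarrow> A \<and> continuous_map X T (f \<circ> g)"
    using continuous_map_funspace[OF L] by (auto simp: topspace_pullback_topology)
next
  assume "g \<in> topspace X \<rightarrow> A \<and> continuous_map X T (f \<circ> g)"
  then show "continuous_map X (pullback_topology A f T) g"
    by (intro continuous_map_pullback') auto
qed

lemma continuous_map_ext_0_iff:
  "continuous_map X (ext_topology 0) f \<longleftrightarrow>
    f \<in> topspace X \<rightarrow> ext_space 0 \<and> continuous_map X euclidean (\<lambda>x. base (f x))"
  by (simp add: continuous_map_pullback_iff o_def)

lemma continuous_map_ext_Suc_iff:
  "continuous_map X (ext_topology (Suc n)) f \<longleftrightarrow>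
    f \<in> topspace X \<rightarrow> ext_space (Suc n) \<and>
    continuous_map X (ext_topology n) (\<lambda>x. ext_pt (f x)) \<and>
    continuous_map X (ext_topology n) (\<lambda>x. ext_dir (f x)) \<and>
    continuous_map X euclidean (\<lambda>x. ext_par (f x))"
  unfolding ext_topology.simps(2) continuous_map_pullback_iff
  by (simp add: o_def continuous_map_paired)

declare ext_topology.simps [simp del]

lemma continuous_map_ext_projections:
  "continuous_map (ext_topology (Suc n)) (ext_topology n) ext_pt"
  "continuous_map (ext_topology (Suc n)) (ext_topology n) ext_dir"
  "continuous_map (ext_topology (Suc n)) euclidean ext_par"
  using continuous_map_ext_Suc_iff[of "ext_topology (Suc n)" n "\<lambda>x. x"] continuous_map_id
  unfolding id_def by blast+

text \<open>The equations of \<open>ext_add\<close> cover only trees of matching shape; membership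
  of both arguments in the same \<open>ext_space\<close> guarantees this.\<close>

lemma ext_add_projections:
  "x \<in> ext_space 0 \<Longrightarrow> y \<in> ext_space 0 \<Longrightarrow> base (ext_add x y) = base x + base y"
  "x \<in> ext_space (Suc n) \<Longrightarrow> y \<in> ext_space (Suc n) \<Longrightarrow>
    ext_pt (ext_add x y) = ext_add (ext_pt x) (ext_pt y)"
  "x \<in> ext_space (Suc n) \<Longrightarrow> y \<in> ext_space (Suc n) \<Longrightarrow>
    ext_dir (ext_add x y) = ext_add (ext_dir x) (ext_dir y)"
  "x \<in> ext_space (Suc n) \<Longrightarrow> y \<in> ext_space (Suc n) \<Longrightarrow>
    ext_par (ext_add x y) = ext_par x + ext_par y"
  by auto

lemma ext_scale_projections:
  "x \<in> ext_space 0 \<Longrightarrow> base (ext_scale smul t x) = smul t (base x)"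
  "x \<in> ext_space (Suc n) \<Longrightarrow> ext_pt (ext_scale smul t x) = ext_scale smul t (ext_pt x)"
  "x \<in> ext_space (Suc n) \<Longrightarrow> ext_dir (ext_scale smul t x) = ext_scale smul t (ext_dir x)"
  "x \<in> ext_space (Suc n) \<Longrightarrow> ext_par (ext_scale smul t x) = t * ext_par x"
  by auto

text \<open>Addition is componentwise, so the universal property reduces level n + 1 to level n and
  to addition in the field. The projection equations hold only on the extended space, hence the
  passage through \<open>continuous_map_eq\<close>.\<close>

lemma continuous_map_ext_add:
  fixes f g :: "'x \<Rightarrow> ('e::topological_monoid_add, 'k::topological_monoid_add) ext_point"
  assumes "continuous_map X (ext_topology n) f" "continuous_map X (ext_topology n) g"
  shows "continuous_map X (ext_topology n) (\<lambda>x. ext_add (f x) (g x))"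
  using assms
proof (induction n arbitrary: f g)
  case 0
  have sp: "f x \<in> ext_space 0" "g x \<in> ext_space 0" if "x \<in> topspace X" for x
    using 0 that unfolding continuous_map_ext_0_iff by blast+
  have "continuous_map X euclidean (\<lambda>x. base (f x) + base (g x))"
    using 0 unfolding continuous_map_ext_0_iff
    by (intro continuous_map_compose2[OF continuous_on_plus_pair]) blast+
  then have "continuous_map X euclidean (\<lambda>x. base (ext_add (f x) (g x)))"
    by (rule continuous_map_eq) (simp only: ext_add_projections(1) sp)
  then show ?case
    unfolding continuous_map_ext_0_iff using sp ext_add_space by blast
next
  case (Suc n)
  note p = Suc.prems[unfolded continuous_map_ext_Suc_iff]
  have sp: "f x \<in> ext_space (Suc n)" "g x \<in> ext_space (Suc n)" if "x \<in> topspace X" for x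
    using p that by blast+
  have "continuous_map X (ext_topology n) (\<lambda>x. ext_add (ext_pt (f x)) (ext_pt (g x)))"
    using p by (intro Suc.IH) simp_all
  then have pt: "continuous_map X (ext_topology n) (\<lambda>x. ext_pt (ext_add (f x) (g x)))"
    by (rule continuous_map_eq) (simp only: ext_add_projections(2)[OF sp])
  have "continuous_map X (ext_topology n) (\<lambda>x. ext_add (ext_dir (f x)) (ext_dir (g x)))"
    using p by (intro Suc.IH) simp_all
  then have dir: "continuous_map X (ext_topology n) (\<lambda>x. ext_dir (ext_add (f x) (g x)))"
    by (rule continuous_map_eq) (simp only: ext_add_projections(3)[OF sp])
  have "continuous_map X euclidean (\<lambda>x. ext_par (f x) + ext_par (g x))"
    using p by (intro continuous_map_compose2[OF continuous_on_plus_pair]) blast+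
  then have "continuous_map X euclidean (\<lambda>x. ext_par (ext_add (f x) (g x)))"
    by (rule continuous_map_eq) (simp only: ext_add_projections(4)[OF sp])
  with pt dir show ?case
    unfolding continuous_map_ext_Suc_iff using sp ext_add_space by blast
qed

section \<open>Openness of the extended domains and uniqueness of \<open>f^[1]\<close>\<close>

context topological_vector_space
begin

lemma continuous_map_smul:
  assumes "continuous_map X euclidean c" "continuous_map X euclidean f"
  shows "continuous_map X euclidean (\<lambda>x. smul (c x) (f x))"
  using continuous_map_compose2[OF continuous_scale assms] .

lemma continuous_map_ext_scale:
  assumes "continuous_map X euclidean c" "continuous_map X (ext_topology n) f"
  shows "continuous_map X (ext_topology n) (\<lambda>x. ext_scale smul (c x) (f x))"
  using assms(2)
proof (induction n arbitrary: f)
  case 0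
  have sp: "f x \<in> ext_space 0" if "x \<in> topspace X" for x
    using 0 that unfolding continuous_map_ext_0_iff by blast
  have "continuous_map X euclidean (\<lambda>x. smul (c x) (base (f x)))"
    using 0 assms(1) unfolding continuous_map_ext_0_iff
    by (intro continuous_map_smul) blast+
  then have "continuous_map X euclidean (\<lambda>x. base (ext_scale smul (c x) (f x)))"
    by (rule continuous_map_eq) (simp only: ext_scale_projections(1) sp)
  then show ?case
    unfolding continuous_map_ext_0_iff using sp ext_scale_space by blast
next
  case (Suc n)
  note p = Suc.prems[unfolded continuous_map_ext_Suc_iff]
  have sp: "f x \<in> ext_space (Suc n)" if "x \<in> topspace X" for x
    using p that by blast
  have "continuous_map X (ext_topology n) (\<lambda>x. ext_scale smul (c x) (ext_pt (f x)))"
    using p by (intro Suc.IH) simp_all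
  then have pt: "continuous_map X (ext_topology n) (\<lambda>x. ext_pt (ext_scale smul (c x) (f x)))"
    by (rule continuous_map_eq) (simp only: ext_scale_projections(2)[OF sp])
  have "continuous_map X (ext_topology n) (\<lambda>x. ext_scale smul (c x) (ext_dir (f x)))"
    using p by (intro Suc.IH) simp_all
  then have dir: "continuous_map X (ext_topology n) (\<lambda>x. ext_dir (ext_scale smul (c x) (f x)))"
    by (rule continuous_map_eq) (simp only: ext_scale_projections(3)[OF sp])
  have "continuous_map X euclidean (\<lambda>x. c x * ext_par (f x))"
    using p assms(1) by (intro continuous_map_compose2[OF continuous_on_times_pair]) blast+
  then have "continuous_map X euclidean (\<lambda>x. ext_par (ext_scale smul (c x) (f x)))"
    by (rule continuous_map_eq) (simp only: ext_scale_projections(4)[OF sp])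
  with pt dir show ?case
    unfolding continuous_map_ext_Suc_iff using sp ext_scale_space by blast
qed

lemma continuous_map_ext_shift:
  "continuous_map (ext_topology (Suc n)) (ext_topology n) (ext_shift smul)"
  unfolding ext_shift_def
  by (intro continuous_map_ext_add continuous_map_ext_scale continuous_map_ext_projections)

lemma openin_ext_dom1:
  assumes "openin (ext_topology n) V"
  shows "openin (ext_topology (Suc n)) (ext_dom1 smul n V)"
proof -
  let ?T = "ext_topology (Suc n) :: ('e, 'k) ext_point topology"
  have V: "V \<subseteq> ext_space n"
    using openin_subset[OF assms] by (simp add: topspace_ext_topology)
  have "ext_dom1 smul n V =
      {p \<in> topspace ?T. ext_pt p \<in> V} \<inter> {p \<in> topspace ?T. ext_shift smul p \<in> V}"
    using ext_dom1_iff[OF V] by (auto simp only: topspace_ext_topology)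
  then show ?thesis
    using openin_continuous_map_preimage[OF continuous_map_ext_projections(1) assms]
      openin_continuous_map_preimage[OF continuous_map_ext_shift assms]
    by (simp only: openin_Int)
qed

lemma openin_ext_dom:
  assumes "open U"
  shows "openin (ext_topology n) (ext_dom smul U n)"
proof (induction n)
  case 0
  have "Base ` U = base -` U \<inter> ext_space 0"
    by force
  then show ?case
    using assms by (auto simp: ext_topology.simps openin_pullback_topology)
next
  case (Suc n)
  then show ?case
    using openin_ext_dom1 by simp
qed

text \<open>For t \<noteq> 0 both values are the difference quotient. For t = 0 they are limits of
  such quotients along s tending to 0 with x and y fixed, and these limits agree because 0 is not
  isolated and the target is Hausdorff.\<close>

lemma is_ext1_unique:
  fixes g h :: "('e, 'k) ext_point \<Rightarrow> 'c::{ab_group_add, t2_space}"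
  assumes V: "openin (ext_topology n) V"
    and g: "is_ext1 smul smul' n V f g" and h: "is_ext1 smul smul' n V f h"
    and p: "p \<in> ext_dom1 smul n V"
  shows "g p = h p"
proof -
  let ?D = "ext_dom1 smul n V"
  have sub: "V \<subseteq> ext_space n"
    using openin_subset[OF V] by (simp add: topspace_ext_topology)
  obtain x y t where pe: "p = Ext x y t" and xy: "x \<in> ext_space n" "y \<in> ext_space n"
    using p sub by (auto simp: ext_dom1_def)
  have eq: "g (Ext x y s) = h (Ext x y s)" if "Ext x y s \<in> ?D" "s \<noteq> 0" for s
    using g h that by (simp add: is_ext1_def)
  show ?thesis
  proof (cases "t = 0")
    case False
    then show ?thesis
      using eq p pe by blast
  next
    case True
    \<comment> \<open>The parameters for which the line with fixed x and y stays in the domain. This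
      is an open neighbourhood of 0, so continuity on the domain yields genuine limits at 0.\<close>
    define T where "T = {s. Ext x y s \<in> ?D}"
    have T0: "0 \<in> T"
      using p pe True by (simp add: T_def)
    have path: "continuous_map euclidean (ext_topology (Suc n)) (Ext x y)"
      unfolding continuous_map_ext_Suc_iff using xy
      by (auto simp: topspace_ext_topology)
    have T: "open T"
      using openin_continuous_map_preimage[OF path openin_ext_dom1[OF V]] by (simp add: T_def)
    have pathT: "continuous_map (top_of_set T) (subtopology (ext_topology (Suc n)) ?D) (Ext x y)"
      using continuous_map_from_subtopology[OF path, of T]
      by (simp add: continuous_map_in_subtopology T_def Pi_def)
    have lim: "((\<lambda>s. f (Ext x y s)) \<longlongrightarrow> f (Ext x y 0)) (at 0)"
      if "continuous_map (subtopology (ext_topology (Suc n)) ?D) euclidean f"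
      for f :: "('e, 'k) ext_point \<Rightarrow> 'c"
    proof -
      have "continuous_on T (f \<circ> Ext x y)"
        using continuous_map_compose[OF pathT that] by (simp only: continuous_map_iff_continuous)
      then have "((f \<circ> Ext x y) \<longlongrightarrow> (f \<circ> Ext x y) 0) (at 0 within T)"
        using T0 unfolding continuous_on_def by blast
      then show ?thesis
        by (simp only: at_within_open[OF T0 T] o_def)
    qed
    have "\<forall>\<^sub>F s in at 0. g (Ext x y s) = h (Ext x y s)"
      unfolding eventually_at_topological using T T0 by (intro exI[of _ T]) (simp add: T_def eq)
    moreover have "((\<lambda>s. g (Ext x y s)) \<longlongrightarrow> g (Ext x y 0)) (at 0)"
      using g unfolding is_ext1_def by (intro lim) simp
    ultimately have "((\<lambda>s. h (Ext x y s)) \<longlongrightarrow> g (Ext x y 0)) (at 0)"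
      by (simp add: tendsto_cong)
    moreover have "((\<lambda>s. h (Ext x y s)) \<longlongrightarrow> h (Ext x y 0)) (at 0)"
      using h unfolding is_ext1_def by (intro lim) simp
    ultimately have "g (Ext x y 0) = h (Ext x y 0)"
      by (rule tendsto_unique[OF at_neq_bot_topological_field])
    then show ?thesis
      using True pe by simp
  qed
qed

end

section \<open>Rational maps\<close>

lemma monoid_mult_monoid: "monoid (mult_monoid :: 'a::monoid_mult monoid)"
  by unfold_locales (auto simp: mult_monoid_def mult.assoc)

lemma mult_monoid_simps [simp]:
  "carrier mult_monoid = UNIV" "x \<otimes>\<^bsub>mult_monoid\<^esub> y = x * y" "\<one>\<^bsub>mult_monoid\<^esub> = 1"
  by (simp_all add: mult_monoid_def)

lemma m_inv_mult_monoid: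
  fixes x :: "'a::monoid_mult"
  assumes "x \<in> Units mult_monoid"
  shows "m_inv mult_monoid x * x = 1" "x * m_inv mult_monoid x = 1"
  using monoid.Units_l_inv[OF monoid_mult_monoid assms]
    monoid.Units_r_inv[OF monoid_mult_monoid assms] by simp_all

text \<open>The resolvent identity: expand the product on the right and cancel. The order of the
  factors matters, since the algebra may be noncommutative.\<close>

lemma m_inv_diff:
  fixes x y :: "'a::{ring, monoid_mult}"
  assumes "x \<in> Units mult_monoid" "y \<in> Units mult_monoid"
  shows "m_inv mult_monoid x - m_inv mult_monoid y =
    - (m_inv mult_monoid x * (x - y) * m_inv mult_monoid y)"
proof -
  have "m_inv mult_monoid x * x * m_inv mult_monoid y = m_inv mult_monoid y"
    using m_inv_mult_monoid(1)[OF assms(1)] by simp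
  moreover have "m_inv mult_monoid x * y * m_inv mult_monoid y = m_inv mult_monoid x"
    using m_inv_mult_monoid(2)[OF assms(2)] by (simp add: mult.assoc)
  ultimately show ?thesis
    by (simp add: algebra_simps)
qed

text \<open>Linearity is condensed into one equation for x + t y, the only combination occurring in
  difference quotients. The target scaling is a parameter, so that scalar-valued functionals such as
  \<open>ext_par\<close> are covered too.\<close>

definition ext_linear ::
    "('k::topological_field \<Rightarrow> 'e::{ab_group_add, topological_space} \<Rightarrow> 'e) \<Rightarrow>
     ('k \<Rightarrow> 'f::{ab_group_add, topological_space} \<Rightarrow> 'f) \<Rightarrow>
     nat \<Rightarrow> (('e, 'k) ext_point \<Rightarrow> 'f) \<Rightarrow> bool" where
  "ext_linear smul smul' n c \<longleftrightarrow> continuous_map (ext_topology n) euclidean c \<and>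
    (\<forall>x\<in>ext_space n. \<forall>y\<in>ext_space n. \<forall>t. c (ext_add x (ext_scale smul t y)) = c x + smul' t (c y))"

lemma ext_linear_shift:
  assumes "ext_linear smul smul' n c" "p \<in> ext_space (Suc n)"
  shows "c (ext_shift smul p) = c (ext_pt p) + smul' (ext_par p) (c (ext_dir p))"
  using assms unfolding ext_linear_def ext_shift_def using ext_pt_space ext_dir_space by blast

lemma ext_linear_ext_pt:
  assumes "ext_linear smul smul' n c"
  shows "ext_linear smul smul' (Suc n) (\<lambda>p. c (ext_pt p))"
  using assms continuous_map_compose[OF continuous_map_ext_projections(1)]
  unfolding ext_linear_def by (fastforce simp: o_def)

lemma ext_linear_ext_dir:
  assumes "ext_linear smul smul' n c"
  shows "ext_linear smul smul' (Suc n) (\<lambda>p. c (ext_dir p))"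
  using assms continuous_map_compose[OF continuous_map_ext_projections(2)]
  unfolding ext_linear_def by (fastforce simp: o_def)

lemma ext_linear_ext_par: "ext_linear smul (*) (Suc n) ext_par"
  using continuous_map_ext_projections(3) unfolding ext_linear_def by fastforce

text \<open>The domain space is kept separate from the algebra: inversion lives on the algebra
  itself, multiplication on its square.\<close>

locale rational_maps =
  A: continuous_inverse_algebra smul + E: topological_vector_space esmul
  for smul :: "'k::topological_field \<Rightarrow>
      'a::{ring, monoid_mult, topological_ab_group_add, topological_semigroup_mult, t2_space} \<Rightarrow> 'a"
    and esmul :: "'k \<Rightarrow> 'e::{topological_ab_group_add, t2_space} \<Rightarrow> 'e"
begin

text \<open>Scaling by functionals is included because the parameter t appears as a factor once a
  map is evaluated at x + t y. The rule \<open>eq_on\<close> makes membership depend only on the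
  values on V, which is needed since \<open>ext_fun\<close> is determined only on its
  domain.\<close>

inductive rational :: "nat \<Rightarrow> ('e, 'k) ext_point set \<Rightarrow> (('e, 'k) ext_point \<Rightarrow> 'a) \<Rightarrow> bool"
  for n V where
  linear: "ext_linear esmul smul n c \<Longrightarrow> rational n V c"
| scale: "ext_linear esmul (*) n c \<Longrightarrow> rational n V f \<Longrightarrow> rational n V (\<lambda>p. smul (c p) (f p))"
| add: "rational n V f \<Longrightarrow> rational n V g \<Longrightarrow> rational n V (\<lambda>p. f p + g p)"
| minus: "rational n V f \<Longrightarrow> rational n V (\<lambda>p. - f p)"
| mult: "rational n V f \<Longrightarrow> rational n V g \<Longrightarrow> rational n V (\<lambda>p. f p * g p)"
| inverse: "rational n V f \<Longrightarrow> f ` V \<subseteq> Units mult_monoid \<Longrightarrow>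
    rational n V (\<lambda>p. m_inv mult_monoid (f p))"
| eq_on: "rational n V f \<Longrightarrow> (\<And>p. p \<in> V \<Longrightarrow> f p = g p) \<Longrightarrow> rational n V g"

lemma rational_continuous:
  assumes "rational n V f"
  shows "continuous_map (subtopology (ext_topology n) V) euclidean f"
  using assms
proof induction
  case (linear c)
  then show ?case
    by (simp add: ext_linear_def continuous_map_from_subtopology)
next
  case (scale c f)
  then show ?case
    by (intro A.continuous_map_smul) (auto simp: ext_linear_def continuous_map_from_subtopology)
next
  case (add f g)
  then show ?case
    by (intro continuous_map_compose2[OF continuous_on_plus_pair])
next
  case (minus f)
  then show ?case
    by (intro continuous_map_uminus)
next
  case (mult f g)
  then show ?case
    by (intro continuous_map_compose2[OF continuous_on_times_pair])
next
  case (inverse f)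
  then have "continuous_map (subtopology (ext_topology n) V) (top_of_set (Units mult_monoid)) f"
    by (auto simp: continuous_map_in_subtopology)
  then have "continuous_map (subtopology (ext_topology n) V) euclidean (m_inv mult_monoid \<circ> f)"
    using A.continuous_on_m_inv continuous_map_compose continuous_map_iff_continuous by blast
  then show ?case
    by (simp add: o_def)
next
  case (eq_on f g)
  then show ?case
    by (metis (mono_tags, lifting) IntD2 continuous_map_eq topspace_subtopology)
qed

lemma rational_ext_pt:
  assumes "rational n V f" "V \<subseteq> ext_space n"
  shows "rational (Suc n) (ext_dom1 esmul n V) (\<lambda>p. f (ext_pt p))"
  using assms(1)
proof induction
  case (inverse f)
  then show ?case
    using assms(2) by (intro rational.inverse) (auto simp: ext_dom1_iff)
next
  case (eq_on f g)
  then show ?case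
    using assms(2) by (elim rational.eq_on) (auto simp: ext_dom1_iff)
qed (auto intro: rational.linear rational.scale rational.add rational.minus rational.mult
    ext_linear_ext_pt)

text \<open>The endpoint map is not linear, but it turns each linear building block into a rational
  map; the other rules are compatible with composition, as endpoints of points of the extended
  domain lie in V.\<close>

lemma rational_ext_shift:
  assumes "rational n V f" and V: "V \<subseteq> ext_space n"
  shows "rational (Suc n) (ext_dom1 esmul n V) (\<lambda>p. f (ext_shift esmul p))"
  using assms(1)
proof induction
  case (linear c)
  have "rational (Suc n) (ext_dom1 esmul n V) (\<lambda>p. c (ext_pt p) + smul (ext_par p) (c (ext_dir p)))"
    by (intro rational.add rational.scale ext_linear_ext_par rational.linear ext_linear_ext_pt
        ext_linear_ext_dir linear)
  then show ?case
    by (rule rational.eq_on) (use ext_dom1_iff[OF V] ext_linear_shift[OF linear] in auto)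
next
  case (scale c f)
  \<comment> \<open>The new coefficient c(x) + t c(y) need not be linear, so it is split into two
    summands, and t c(y) is realised by two nested scalings.\<close>
  have "rational (Suc n) (ext_dom1 esmul n V) (\<lambda>p. smul (c (ext_pt p)) (f (ext_shift esmul p)) +
      smul (ext_par p) (smul (c (ext_dir p)) (f (ext_shift esmul p))))"
    by (intro rational.add rational.scale ext_linear_ext_par ext_linear_ext_pt
        ext_linear_ext_dir scale)
  then show ?case
    by (rule rational.eq_on)
      (use ext_dom1_iff[OF V] ext_linear_shift[OF scale.hyps(1)] in
        \<open>auto simp: A.scale_left_distrib\<close>)
next
  case (inverse f)
  then show ?case
    by (intro rational.inverse) (auto simp: ext_dom1_iff[OF V])
next
  case (eq_on f g)
  show ?case
    by (rule rational.eq_on[OF eq_on.IH]) (use eq_on.hyps(2) in \<open>auto simp: ext_dom1_iff[OF V]\<close>)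
qed (auto intro: rational.add rational.minus rational.mult)

text \<open>Each rule has a difference formula: linearity, a product rule, or the resolvent
  identity. Keeping the factor t on the right instead of dividing avoids a separate case t = 0 and
  lets the identity pass through the induction.\<close>

lemma rational_difference_quotient:
  assumes "rational n V f" and V: "V \<subseteq> ext_space n"
  shows "\<exists>g. rational (Suc n) (ext_dom1 esmul n V) g \<and>
    (\<forall>p\<in>ext_dom1 esmul n V. f (ext_shift esmul p) - f (ext_pt p) = smul (ext_par p) (g p))"
  using assms(1)
proof induction
  case (linear c)
  then show ?case
    using ext_dom1_iff[OF V] ext_linear_shift[OF linear]
    by (intro exI[of _ "\<lambda>p. c (ext_dir p)"]) (auto intro: rational.linear ext_linear_ext_dir)
next
  case (scale c f)
  then obtain g where g: "rational (Suc n) (ext_dom1 esmul n V) g"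
    "\<forall>p\<in>ext_dom1 esmul n V. f (ext_shift esmul p) - f (ext_pt p) = smul (ext_par p) (g p)"
    by blast
  \<comment> \<open>With primes for values at the endpoint, this comes from c' f' - c f = c (f' - f)
    + (c' - c) f' by extracting the factor t from both brackets.\<close>
  let ?g = "\<lambda>p. smul (c (ext_pt p)) (g p) + smul (c (ext_dir p)) (f (ext_shift esmul p))"
  have "rational (Suc n) (ext_dom1 esmul n V) ?g"
    by (intro rational.add rational.scale ext_linear_ext_pt ext_linear_ext_dir scale
        rational_ext_shift V g)
  moreover have "smul (c (ext_shift esmul p)) (f (ext_shift esmul p)) - smul (c (ext_pt p)) (f (ext_pt p)) =
      smul (ext_par p) (?g p)" if p: "p \<in> ext_dom1 esmul n V" for p
  proof -
    have "smul (c (ext_pt p)) (f (ext_shift esmul p)) - smul (c (ext_pt p)) (f (ext_pt p)) =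
        smul (ext_par p) (smul (c (ext_pt p)) (g p))"
      using g(2) p by (simp flip: A.scale_right_diff_distrib add: A.scale_left_commute)
    moreover have "c (ext_shift esmul p) = c (ext_pt p) + ext_par p * c (ext_dir p)"
      using ext_linear_shift[OF scale.hyps(1)] p by (simp add: ext_dom1_iff[OF V])
    ultimately show ?thesis
      by (simp add: A.scale_left_distrib A.scale_right_distrib algebra_simps)
  qed
  ultimately show ?case
    by blast
next
  case (add f f')
  then obtain g g' where g: "rational (Suc n) (ext_dom1 esmul n V) g"
    "\<forall>p\<in>ext_dom1 esmul n V. f (ext_shift esmul p) - f (ext_pt p) = smul (ext_par p) (g p)"
    "rational (Suc n) (ext_dom1 esmul n V) g'"
    "\<forall>p\<in>ext_dom1 esmul n V. f' (ext_shift esmul p) - f' (ext_pt p) = smul (ext_par p) (g' p)"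
    by blast
  then show ?case
    by (intro exI[of _ "\<lambda>p. g p + g' p"])
      (simp add: rational.add add_diff_add A.scale_right_distrib)
next
  case (minus f)
  then obtain g where g: "rational (Suc n) (ext_dom1 esmul n V) g"
    "\<forall>p\<in>ext_dom1 esmul n V. f (ext_shift esmul p) - f (ext_pt p) = smul (ext_par p) (g p)"
    by blast
  then have "\<forall>p\<in>ext_dom1 esmul n V. - f (ext_shift esmul p) - - f (ext_pt p) = smul (ext_par p) (- g p)"
    by (metis A.scale_minus_right minus_diff_minus)
  with g(1) show ?case
    by (intro exI[of _ "\<lambda>p. - g p"]) (simp add: rational.minus)
next
  case (mult f f')
  then obtain g g' where g: "rational (Suc n) (ext_dom1 esmul n V) g"
    "\<forall>p\<in>ext_dom1 esmul n V. f (ext_shift esmul p) - f (ext_pt p) = smul (ext_par p) (g p)"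
    "rational (Suc n) (ext_dom1 esmul n V) g'"
    "\<forall>p\<in>ext_dom1 esmul n V. f' (ext_shift esmul p) - f' (ext_pt p) = smul (ext_par p) (g' p)"
    by blast
  \<comment> \<open>The noncommutative product rule: change the left factor first, with the right
    factor at the endpoint, then the right factor.\<close>
  let ?g = "\<lambda>p. g p * f' (ext_shift esmul p) + f (ext_pt p) * g' p"
  have "rational (Suc n) (ext_dom1 esmul n V) ?g"
    by (intro rational.add rational.mult rational_ext_shift rational_ext_pt mult V g)
  moreover have "f (ext_shift esmul p) * f' (ext_shift esmul p) - f (ext_pt p) * f' (ext_pt p) =
      smul (ext_par p) (?g p)" if p: "p \<in> ext_dom1 esmul n V" for p
  proof -
    have "f (ext_shift esmul p) * f' (ext_shift esmul p) - f (ext_pt p) * f' (ext_pt p) =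
        (f (ext_shift esmul p) - f (ext_pt p)) * f' (ext_shift esmul p) +
        f (ext_pt p) * (f' (ext_shift esmul p) - f' (ext_pt p))"
      by (simp add: algebra_simps)
    also have "\<dots> = smul (ext_par p) (?g p)"
      using g(2,4) p
      by (simp add: A.scale_mult_left A.scale_mult_right A.scale_right_distrib)
    finally show ?thesis .
  qed
  ultimately show ?case
    by blast
next
  case (inverse f)
  then obtain g where g: "rational (Suc n) (ext_dom1 esmul n V) g"
    "\<forall>p\<in>ext_dom1 esmul n V. f (ext_shift esmul p) - f (ext_pt p) = smul (ext_par p) (g p)"
    by blast
  let ?i = "m_inv (mult_monoid :: 'a monoid)"
  \<comment> \<open>The resolvent identity for the values of f at endpoint and base point, with
    their difference replaced by t g.\<close>
  let ?g = "\<lambda>p. - (?i (f (ext_shift esmul p)) * g p * ?i (f (ext_pt p)))"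
  have "rational n V (\<lambda>p. ?i (f p))"
    using inverse.hyps by (rule rational.inverse)
  then have "rational (Suc n) (ext_dom1 esmul n V) ?g"
    using rational_ext_shift[OF _ V] rational_ext_pt[OF _ V] g(1)
    by (intro rational.minus rational.mult) blast+
  moreover have "?i (f (ext_shift esmul p)) - ?i (f (ext_pt p)) = smul (ext_par p) (?g p)"
    if p: "p \<in> ext_dom1 esmul n V" for p
  proof -
    have "f (ext_shift esmul p) \<in> Units mult_monoid" "f (ext_pt p) \<in> Units mult_monoid"
      using p inverse.hyps(2) by (auto simp: ext_dom1_iff[OF V])
    then show ?thesis
      using g(2) p by (simp add: m_inv_diff A.scale_mult_left A.scale_mult_right)
  qed
  ultimately show ?case
    by blast
next
  case (eq_on f f')
  then show ?case
    by (simp add: ext_dom1_iff[OF V])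
qed

section \<open>From difference quotients to smoothness\<close>

lemma rational_is_ext1:
  assumes "rational n V f" "V \<subseteq> ext_space n"
  shows "\<exists>g. rational (Suc n) (ext_dom1 esmul n V) g \<and> is_ext1 esmul smul n V f g"
proof -
  obtain g where g: "rational (Suc n) (ext_dom1 esmul n V) g"
    "\<forall>p\<in>ext_dom1 esmul n V. f (ext_shift esmul p) - f (ext_pt p) = smul (ext_par p) (g p)"
    using rational_difference_quotient[OF assms] by blast
  \<comment> \<open>Only here is the identity divided by the nonzero parameter t.\<close>
  have "g (Ext x y t) = smul (1 / t) (f (ext_add x (ext_scale esmul t y)) - f x)"
    if "Ext x y t \<in> ext_dom1 esmul n V" "t \<noteq> 0" for x y t
    using g(2) that by fastforce
  then show ?thesis
    using g(1) rational_continuous[OF g(1)] by (auto simp: is_ext1_def)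
qed

text \<open>The next extension is a Hilbert choice. A rational candidate exists, so the chosen map
  is also a valid extension; by uniqueness it equals the candidate on the open domain, and
  \<open>eq_on\<close> makes it rational.\<close>

lemma rational_ext_fun:
  assumes U: "open U" and f: "rational 0 (Base ` U) (f \<circ> base)"
  shows "rational k (ext_dom esmul U k) (ext_fun esmul smul U f k)"
proof (induction k)
  case 0
  then show ?case
    using f by (simp only: ext_dom.simps ext_fun.simps)
next
  case (Suc k)
  obtain g where g: "rational (Suc k) (ext_dom esmul U (Suc k)) g"
    "is_ext1 esmul smul k (ext_dom esmul U k) (ext_fun esmul smul U f k) g"
    using rational_is_ext1[OF Suc ext_dom_subset] by auto
  have "is_ext1 esmul smul k (ext_dom esmul U k) (ext_fun esmul smul U f k)
      (ext_fun esmul smul U f (Suc k))"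
    using someI[of "is_ext1 esmul smul k (ext_dom esmul U k) (ext_fun esmul smul U f k)", OF g(2)]
    by simp
  then show ?case
    using E.is_ext1_unique[OF E.openin_ext_dom[OF U] g(2)]
    by (intro rational.eq_on[OF g(1)]) simp
qed

lemma rational_C_infinity_on:
  assumes U: "open U" and f: "rational 0 (Base ` U) (f \<circ> base)"
  shows "C_infinity_on esmul smul U f"
proof -
  have "C_k_on k esmul smul U f" for k
  proof (induction k)
    case 0
    have "continuous_map (top_of_set U) (subtopology (ext_topology 0) (Base ` U)) Base"
      using continuous_map_from_subtopology[of euclidean euclidean "\<lambda>x. x" U]
      by (auto simp: continuous_map_in_subtopology continuous_map_ext_0_iff)
    from continuous_map_compose[OF this rational_continuous[OF f]] have "continuous_on U f"
      by (simp add: o_def)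
    with U show ?case
      by simp
  next
    case (Suc k)
    have "rational k (ext_dom esmul U k) (ext_fun esmul smul U f k)"
      using rational_ext_fun[OF U f] .
    with Suc show ?case
      using rational_continuous rational_is_ext1[OF _ ext_dom_subset]
      unfolding C_k_on.simps ext_C1_def by blast
  qed
  then show ?thesis
    by (simp add: C_infinity_on_def)
qed

lemma rational_linear_base:
  assumes "continuous_on UNIV l" "\<And>x y. l (x + y) = l x + l y" "\<And>t x. l (esmul t x) = smul t (l x)"
  shows "rational 0 V (l \<circ> base)"
proof (rule rational.linear)
  have "continuous_map (ext_topology 0) euclidean base"
    using continuous_map_ext_0_iff[of "ext_topology 0" "\<lambda>x. x"] continuous_map_id
    unfolding id_def by blast
  then have "continuous_map (ext_topology 0) euclidean (l \<circ> base)"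
    using assms(1) by (meson continuous_map_compose continuous_map_iff_continuous2)
  then show "ext_linear esmul smul 0 (l \<circ> base)"
    using assms(2,3) by (auto simp: ext_linear_def)
qed

end

section \<open>The group of units\<close>

lemma topological_vector_space_prod_scale:
  assumes "topological_vector_space smul" "topological_vector_space smul'"
  shows "topological_vector_space (prod_scale smul smul')"
proof -
  interpret E: topological_vector_space smul by fact
  interpret F: topological_vector_space smul' by fact
  show ?thesis
  proof
    have "continuous_on UNIV (\<lambda>z. (\<lambda>(t, x). smul t x) (fst z, fst (snd z)))"
      "continuous_on UNIV (\<lambda>z. (\<lambda>(t, x). smul' t x) (fst z, snd (snd z)))"
      by (intro continuous_on_compose2[OF E.continuous_scale]
          continuous_on_compose2[OF F.continuous_scale] continuous_intros; simp)+
    from continuous_on_Pair[OF this]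
    show "continuous_on UNIV (\<lambda>(t, x). prod_scale smul smul' t x)"
      by (simp add: case_prod_beta prod_scale_def map_prod_def)
  qed (auto simp: prod_scale_def E.scale_right_distrib F.scale_right_distrib
      E.scale_left_distrib F.scale_left_distrib)
qed

section \<open>Smoothness of inversion, identity and multiplication\<close>

context continuous_inverse_algebra
begin

text \<open>Inversion is the rule \<open>inverse\<close> applied to the identity. Allowing any f
  that agrees with it on the units covers the inverse of the group of units and its chart expression
  with \<open>inv_into\<close>.\<close>

lemma C_infinity_on_inverse:
  assumes "\<And>x. x \<in> Units mult_monoid \<Longrightarrow> f x = m_inv mult_monoid x"
  shows "C_infinity_on smul smul (Units mult_monoid) f"
proof -
  interpret rational_maps smul smul ..
  have "rational 0 (Base ` Units mult_monoid) ((\<lambda>x. x) \<circ> base)"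
    by (rule rational_linear_base) auto
  then have "rational 0 (Base ` Units mult_monoid) (\<lambda>p. m_inv mult_monoid (base p))"
    by (intro rational.inverse) (auto simp: o_def)
  then have "rational 0 (Base ` Units mult_monoid) (f \<circ> base)"
    by (rule rational.eq_on) (use assms in auto)
  then show ?thesis
    using open_Units by (rule rational_C_infinity_on[rotated])
qed

lemma C_infinity_on_identity:
  assumes "open U" "\<And>x. x \<in> U \<Longrightarrow> f x = x"
  shows "C_infinity_on smul smul U f"
proof -
  interpret rational_maps smul smul ..
  have "rational 0 (Base ` U) ((\<lambda>x. x) \<circ> base)"
    by (rule rational_linear_base) auto
  then have "rational 0 (Base ` U) (f \<circ> base)"
    by (rule rational.eq_on) (use assms(2) in auto)
  with assms(1) show ?thesis
    by (rule rational_C_infinity_on)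
qed

text \<open>Multiplication is the pointwise product of the two coordinate projections, which are
  continuous and linear on the square of the algebra.\<close>

lemma C_infinity_on_mult:
  assumes "open U" "\<And>x y. (x, y) \<in> U \<Longrightarrow> f (x, y) = x * y"
  shows "C_infinity_on (prod_scale smul smul) smul U f"
proof -
  interpret P: topological_vector_space "prod_scale smul smul"
    by (intro topological_vector_space_prod_scale) unfold_locales
  interpret rational_maps smul "prod_scale smul smul" ..
  have "rational 0 (Base ` U) (fst \<circ> base)" "rational 0 (Base ` U) (snd \<circ> base)"
    by (auto intro!: rational_linear_base continuous_intros simp: prod_scale_def)
  then have "rational 0 (Base ` U) (\<lambda>p. (fst \<circ> base) p * (snd \<circ> base) p)"
    by (rule rational.mult)
  then have "rational 0 (Base ` U) (f \<circ> base)"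
    by (rule rational.eq_on) (use assms(2) in auto)
  with assms(1) show ?thesis
    by (rule rational_C_infinity_on)
qed

end

section \<open>The Lie group structure on the units\<close>

lemma Hausdorff_space_t2: "Hausdorff_space (euclidean :: 'a::t2_space topology)"
proof -
  have "\<exists>U V. openin euclidean U \<and> openin euclidean V \<and> x \<in> U \<and> y \<in> V \<and> disjnt U V"
    if "x \<noteq> y" for x y :: 'a
    using hausdorff[OF that] by (simp add: disjnt_def)
  then show ?thesis
    unfolding Hausdorff_space_def by blast
qed

lemma open_submanifold_model_atlas: "open_submanifold_atlas W model_atlas = {(W, \<lambda>x. x)}"
  by (auto simp: open_submanifold_atlas_def model_atlas_def)

lemma inv_into_ident: "x \<in> W \<Longrightarrow> inv_into W (\<lambda>x. x) x = x"
  using inv_into_f_f[of "\<lambda>x. x" W x] by (simp add: inj_on_def)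

theorem proposition2p2:
  fixes smul :: "'k::topological_field \<Rightarrow>
      'a::{ring, monoid_mult, topological_ab_group_add, topological_semigroup_mult, t2_space} \<Rightarrow> 'a"
  assumes "continuous_inverse_algebra smul"
  shows "C_infinity_on smul smul (Units (mult_monoid :: 'a monoid)) (m_inv mult_monoid) \<and>
    lie_group smul (units_of (mult_monoid :: 'a monoid))
      (top_of_set (Units (mult_monoid :: 'a monoid)))
      (open_submanifold_atlas (Units (mult_monoid :: 'a monoid)) model_atlas)"
proof -
  interpret continuous_inverse_algebra smul by fact
  interpret M: monoid "mult_monoid :: 'a monoid"
    by (rule monoid_mult_monoid)
  let ?U = "Units (mult_monoid :: 'a monoid)"
  let ?G = "units_of (mult_monoid :: 'a monoid)"
  have mult_closed: "x * y \<in> ?U" if "x \<in> ?U" "y \<in> ?U" for x y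
    using M.Units_m_closed that by fastforce
  have prod_atlas: "prod_atlas {(?U, \<lambda>x. x)} {(?U, \<lambda>x. x)} = {(?U \<times> ?U, \<lambda>x. x)}"
    by (auto simp: prod_atlas_def map_prod.identity map_prod_def)
  have manifold: "smooth_manifold smul (top_of_set ?U) {(?U, \<lambda>x. x)}"
  proof -
    have "homeomorphic_map (subtopology (top_of_set ?U) ?U) (top_of_set ((\<lambda>x. x) ` ?U)) (\<lambda>x. x)"
      using homeomorphic_map_id[of "top_of_set ?U" "top_of_set ?U"]
      by (simp add: id_def subtopology_subtopology)
    \<comment> \<open>The atlas has one chart, and its only transition map agrees with the identity
      on the units.\<close>
    then show ?thesis
      using open_Units
      by (auto simp: smooth_manifold_def is_chart_def Hausdorff_space_subtopology inv_into_ident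
          Hausdorff_space_t2 intro!: C_infinity_on_identity)
  qed
  have mult: "smooth_map (prod_scale smul smul) (prod_topology (top_of_set ?U) (top_of_set ?U))
      {(?U \<times> ?U, \<lambda>x. x)} smul (top_of_set ?U) {(?U, \<lambda>x. x)} (\<lambda>(x, y). x \<otimes>\<^bsub>?G\<^esub> y)"
  proof -
    \<comment> \<open>Products of units are units, so the chart expression of multiplication has the
      whole square as its domain.\<close>
    have "{z \<in> ?U \<times> ?U. (case z of (x, y) \<Rightarrow> x \<otimes>\<^bsub>?G\<^esub> y) \<in> ?U} = ?U \<times> ?U"
      using mult_closed by (auto simp: units_of_mult)
    moreover have "continuous_on (?U \<times> ?U) (\<lambda>(x, y). x * y)"
      using continuous_on_times_pair continuous_on_subset by blast
    ultimately show ?thesis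
      using open_Units mult_closed
      by (auto simp: smooth_map_def units_of_mult continuous_map_in_subtopology inv_into_ident
          intro!: C_infinity_on_mult open_Times)
  qed
  have inverse: "smooth_map smul (top_of_set ?U) {(?U, \<lambda>x. x)} smul (top_of_set ?U) {(?U, \<lambda>x. x)}
      (m_inv ?G)"
  proof -
    have "{x \<in> ?U. m_inv ?G x \<in> ?U} = ?U"
      using M.units_of_inv M.Units_inv_Units by auto
    moreover have "continuous_on ?U (m_inv ?G)"
      using continuous_on_m_inv M.units_of_inv by (simp cong: continuous_on_cong)
    ultimately show ?thesis
      by (auto simp: smooth_map_def continuous_map_in_subtopology inv_into_ident M.units_of_inv
          intro!: C_infinity_on_inverse)
  qed
  have "topological_vector_space smul"
    by unfold_locales
  then have "lie_group smul ?G (top_of_set ?U) {(?U, \<lambda>x. x)}"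
    using manifold mult inverse M.units_group
    by (simp add: lie_group_def units_of_carrier prod_atlas)
  then show ?thesis
    by (simp add: open_submanifold_model_atlas C_infinity_on_inverse)
qed

end
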